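(* Let $p>1$ and $r=\frac1{p-1}$. Let $g,\tilde g\in L^2(0,1)$, and let $u$ and $\tilde u$ be the solutions of the $p$-Poisson boundary value problem \[ (\llbracket u'\rrbracket^{p-1})'=g \ \text{ on } 0\le x\le 1,\qquad u(0)=u(1)=0, \] with corresponding sources $g$ and $\tilde g$ respectively. Let $m=\max\{\|g\|_1,\|\tilde g\|_1\}$. Then \[ \|u-\tilde{u}\|\leq 2^{1-r} \left(\|g-\tilde{g}\|+\frac{(4m)^{1-r}}{r} \|g-\tilde{g}\|_1^r\right)^{r} \qquad \text{if } 0<r\leq 1, \] and \[ \|u-\tilde{u}\|\leq r2^{r-1}m^{r-1}\left(\|g-\tilde{g}\|+2^{2-2/r}m^{1-1/r}r^{1/r}\|g-\tilde{g}\|_1^{1/r}\right) \qquad \text{if } r>1. \]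
   Context: $\|\cdot\|$ is the norm of $L^2(0,1)$ and $\|\cdot\|_1$ the norm of $L^1(0,1)$; functions are real-valued. For $z\in\mathbb{R}$ and $a>0$ write $\llbracket z\rrbracket^{a}=z|z|^{a-1}$ (equal to $0$ at $z=0$), so $\llbracket z\rrbracket^{p-1}=z|z|^{p-2}$. A solution of the $p$-Poisson problem is a function $u:[0,1]\to\mathbb{R}$ with $\llbracket u'\rrbracket^{p-1}\in H^1(0,1)$ satisfying the equation and the boundary conditions. For each source $g$ the solution exists, is unique and is given by \[ u(x)=\int_0^x\llbracket Vg(\tau)-\gamma_0(g)\rrbracket^{\frac1{p-1}}\,\mathrm{d}\tau, \] where $Vg(x)=\int_0^xg(t)\,\mathrm{d}t$ and $\gamma_0(g)$ is the unique real number with $\int_0^1\llbracket Vg(\tau)-\gamma_0(g)\rrbracket^{\frac1{p-1}}\,\mathrm{d}\tau=0$. *)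

theory Defs
  imports "HOL-Analysis.Analysis"
begin

text \<open>The signed power \<open>z |z|^(a - 1)\<close>.\<close>

definition spow :: "real \<Rightarrow> real \<Rightarrow> real" where
  "spow z a = z * \<bar>z\<bar> powr (a - 1)"

abbreviation unit_ivl :: "real set" where
  "unit_ivl \<equiv> {0<..<1}"

text \<open>Elements of \<open>L\<^sup>2(S)\<close> are represented by functions, not by classes modulo null sets;
  the notions below depend only on the classes.\<close>

definition L2_space :: "real set \<Rightarrow> (real \<Rightarrow> real) set" where
  "L2_space S = {f \<in> borel_measurable (lebesgue_on S). integrable (lebesgue_on S) (\<lambda>x. (f x)\<^sup>2)}"

definition L1_norm :: "real set \<Rightarrow> (real \<Rightarrow> real) \<Rightarrow> real" where
  "L1_norm S f = (LINT x|lebesgue_on S. \<bar>f x\<bar>)"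

definition L2_norm :: "real set \<Rightarrow> (real \<Rightarrow> real) \<Rightarrow> real" where
  "L2_norm S f = sqrt (LINT x|lebesgue_on S. (f x)\<^sup>2)"

definition locally_integrable_on :: "(real \<Rightarrow> real) \<Rightarrow> real set \<Rightarrow> bool" where
  "locally_integrable_on f S \<longleftrightarrow> (\<forall>K. compact K \<and> K \<subseteq> S \<longrightarrow> f absolutely_integrable_on K)"

text \<open>Test functions of class \<open>C\<^sup>1\<close> with compact support in \<open>S\<close>, as in Brezis's definition of
  Sobolev spaces in one dimension; by mollification, smooth test functions give the same weak
  derivatives on an open set.\<close>

definition test_functions :: "real set \<Rightarrow> (real \<Rightarrow> real) set" where
  "test_functions S = {\<phi>. \<phi> C1_differentiable_on UNIV \<and>
     compact (closure {x. \<phi> x \<noteq> 0}) \<and> closure {x. \<phi> x \<noteq> 0} \<subseteq> S}"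

definition has_weak_derivative_on ::
    "(real \<Rightarrow> real) \<Rightarrow> (real \<Rightarrow> real) \<Rightarrow> real set \<Rightarrow> bool" where
  "has_weak_derivative_on f h S \<longleftrightarrow>
     locally_integrable_on f S \<and> locally_integrable_on h S \<and>
     (\<forall>\<phi>\<in>test_functions S.
        (LINT x|lebesgue_on S. f x * deriv \<phi> x) = - (LINT x|lebesgue_on S. h x * \<phi> x))"

definition H1_space :: "real set \<Rightarrow> (real \<Rightarrow> real) set" where
  "H1_space S = {f \<in> L2_space S. \<exists>h\<in>L2_space S. has_weak_derivative_on f h S}"

text \<open>Both derivatives are weak ones: \<open>v\<close> represents \<open>u'\<close>, and the equation says that the weak
  derivative of the signed power of \<open>u'\<close> is \<open>g\<close>, i.e. it holds almost everywhere. (With a merely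
  almost-everywhere derivative \<open>u'\<close>, Cantor-type functions would destroy uniqueness.)
  Continuity of \<open>u\<close> selects the representative for which the boundary values make sense.\<close>

definition p_poisson_solution :: "real \<Rightarrow> (real \<Rightarrow> real) \<Rightarrow> (real \<Rightarrow> real) \<Rightarrow> bool" where
  "p_poisson_solution p g u \<longleftrightarrow>
     continuous_on {0..1} u \<and> u 0 = 0 \<and> u 1 = 0 \<and>
     (\<exists>v. has_weak_derivative_on u v unit_ivl \<and>
          (\<lambda>x. spow (v x) (p - 1)) \<in> H1_space unit_ivl \<and>
          has_weak_derivative_on (\<lambda>x. spow (v x) (p - 1)) g unit_ivl)"

end

theory Submission
  imports Defs
begin

text \<open>The weak equations are integrated with the lemma of du Bois-Reymond: the solution is
  \<open>u x = \<integral>\<^sub>0\<^sup>x spow (w t) r dt\<close> with \<open>w x = c + \<integral>\<^sub>0\<^sup>x g\<close>. For two solutions the integrals of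
  \<open>spow w r\<close> and \<open>spow w2 r\<close> over \<open>[0, 1]\<close> both vanish, so \<open>w\<close> and \<open>w2\<close> coincide at some point,
  and hence differ by at most \<open>\<parallel>g - g2\<parallel>\<^sub>1\<close> everywhere; likewise \<open>w\<close> has a zero, so that
  \<open>\<bar>w\<bar> \<le> \<parallel>g\<parallel>\<^sub>1\<close>. The Hoelder (\<open>r \<le> 1\<close>) or Lipschitz (\<open>r > 1\<close>) estimate for the signed power then
  bounds \<open>u - u2\<close> uniformly, and both right-hand sides dominate that bound.\<close>

section \<open>Fubini's theorem on a triangle\<close>

text \<open>Product integrals over \<open>lborel\<close> call for Borel functions, while
  \<open>f\<close> is only Lebesgue measurable. A function measurable for the completion agrees
  almost everywhere with a Borel one, and the exceptional set is invisible to integrals.\<close>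

lemma absolutely_integrable_borel_version:
  fixes f :: "real \<Rightarrow> real"
  assumes "f absolutely_integrable_on S"
  obtains f' N where "integrable lborel f'" "negligible N"
    "\<And>x. x \<notin> N \<Longrightarrow> f' x = (if x \<in> S then f x else 0)"
proof -
  define f0 where "f0 x = (if x \<in> S then f x else 0)" for x
  have f0: "integrable lebesgue f0"
  proof -
    have "f0 = (\<lambda>x. indicat_real S x *\<^sub>R f x)" by (auto simp: f0_def fun_eq_iff)
    then show ?thesis using assms by (simp add: set_integrable_def)
  qed
  then obtain f' where f': "f' \<in> borel_measurable lborel" "AE x in lborel. f0 x = f' x"
    using completion_ex_borel_measurable_real[of f0 lborel] by auto
  have ae: "AE x in lebesgue. f0 x = f' x" using f' by (simp add: AE_completion)
  then have "integrable lebesgue f'"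
    using f0 f'(1) by (subst integrable_cong_AE[of f' _ f0]) (auto intro: measurable_completion elim: eventually_mono)
  then have 1: "integrable lborel f'" using f'(1) integrable_completion by blast
  obtain N where "N \<in> null_sets lebesgue" and sub: "{x \<in> space lebesgue. f0 x \<noteq> f' x} \<subseteq> N"
    using ae unfolding eventually_ae_filter by auto
  have "f' x = f0 x" if "x \<notin> N" for x
    using subsetD[OF sub, of x] that by (auto simp: eq_commute)
  with \<open>N \<in> null_sets lebesgue\<close> 1 show ?thesis
    by (intro that[of f' N]) (auto simp: negligible_iff_null_sets f0_def)
qed

text \<open>Both sides are iterated integrals of \<open>f x * g t\<close> over the triangle a \<le>
  t \<le> x \<le> b. This serves as integration by parts when \<open>g\<close> is merely
  integrable.\<close>

lemma integral_triangle_swap: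
  fixes f g :: "real \<Rightarrow> real"
  assumes f: "f absolutely_integrable_on {a..b}" and g: "g absolutely_integrable_on {a..b}"
  shows "integral {a..b} (\<lambda>x. f x * integral {a..x} g) = integral {a..b} (\<lambda>t. g t * integral {t..b} f)"
proof -
  obtain f' M where f': "integrable lborel f'" "negligible M"
    "\<And>x. x \<notin> M \<Longrightarrow> f' x = (if x \<in> {a..b} then f x else 0)"
    using absolutely_integrable_borel_version[OF f] by blast
  obtain g' N where g': "integrable lborel g'" "negligible N"
    "\<And>x. x \<notin> N \<Longrightarrow> g' x = (if x \<in> {a..b} then g x else 0)"
    using absolutely_integrable_borel_version[OF g] by blast
  have [measurable]: "f' \<in> borel_measurable borel" "g' \<in> borel_measurable borel"
    using f'(1) g'(1) by (auto dest: borel_measurable_integrable)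
  \<comment> \<open>One indicator suffices to cut out the triangle: off null sets \<open>f'\<close>
    and \<open>g'\<close> vanish outside \<open>{a..b}\<close>, which supplies the outer bounds a
    \<le> t and x \<le> b. The next fact reads the same triangle from the other variable.\<close>
  define k where "k x t = f' x * (g' t * indicator {..x} t)" for x t
  have k': "k x t = g' t * (f' x * indicator {t..} x)" for x t
    by (auto simp: k_def indicator_def)
  have indl: "integrable lborel (\<lambda>t. g' t * indicator {..x} t)" for x
    using integrable_mult_indicator[OF _ g'(1), of "{..x}"] by (simp add: mult.commute)
  have indr: "integrable lborel (\<lambda>t. f' t * indicator {x..} t)" for x
    using integrable_mult_indicator[OF _ f'(1), of "{x..}"] by (simp add: mult.commute)
  have m: "(\<lambda>p. k (fst p) (snd p)) \<in> borel_measurable (lborel \<Otimes>\<^sub>M lborel)"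
  proof -
    have [measurable]: "Measurable.pred (lborel \<Otimes>\<^sub>M lborel) (\<lambda>p :: real \<times> real. snd p \<le> fst p)"
      by measurable
    have "(\<lambda>p. k (fst p) (snd p)) = (\<lambda>p. f' (fst p) * (g' (snd p) * (if snd p \<le> fst p then 1 else 0)))"
      by (auto simp: k_def indicator_def fun_eq_iff)
    also have "\<dots> \<in> borel_measurable (lborel \<Otimes>\<^sub>M lborel)" by measurable
    finally show ?thesis .
  qed
  then have m': "case_prod k \<in> borel_measurable (lborel \<Otimes>\<^sub>M lborel)"
    by (simp add: case_prod_beta')
  have ik: "integrable (lborel \<Otimes>\<^sub>M lborel) (case_prod k)"
  \<comment> \<open>The indicator only decreases absolute values, so the tensor product of the two
    integrable functions is a majorant.\<close>
  proof (rule Bochner_Integration.integrable_bound[OF _ m'])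
    show "integrable (lborel \<Otimes>\<^sub>M lborel) (\<lambda>p. f' (fst p) * g' (snd p))"
    proof (rule lborel_pair.Fubini_integrable)
      show "integrable lborel (\<lambda>x. LINT y|lborel. norm (f' (fst (x, y)) * g' (snd (x, y))))"
        using f'(1) by (simp add: abs_mult)
      show "AE x in lborel. integrable lborel (\<lambda>y. f' (fst (x, y)) * g' (snd (x, y)))"
        using g'(1) by simp
    qed measurable
    show "AE x in lborel \<Otimes>\<^sub>M lborel. norm (case x of (x, xa) \<Rightarrow> k x xa) \<le> norm (f' (fst x) * g' (snd x))"
      by (auto simp: k_def indicator_def)
  qed
  have G: "(LINT t|lborel. k x t) = f' x * integral {a..x} g" if "x \<in> {a..b}" for x
  proof -
    have "(LINT t|lborel. g' t * indicator {..x} t) = integral UNIV (\<lambda>t. g' t * indicator {..x} t)"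
      by (simp add: integral_lborel indl)
    also have "\<dots> = integral UNIV (\<lambda>t. if t \<in> {a..x} then g t else 0)"
      by (rule integral_spike[OF g'(2)]) (use that in \<open>auto simp: g'(3) indicator_def\<close>)
    also have "\<dots> = integral {a..x} g" by (rule Henstock_Kurzweil_Integration.integral_restrict_UNIV)
    finally show ?thesis by (simp add: k_def)
  qed
  have F: "(LINT x|lborel. k x t) = g' t * integral {t..b} f" if "t \<in> {a..b}" for t
  proof -
    have "(LINT x|lborel. f' x * indicator {t..} x) = integral UNIV (\<lambda>x. f' x * indicator {t..} x)"
      by (simp add: integral_lborel indr)
    also have "\<dots> = integral UNIV (\<lambda>x. if x \<in> {t..b} then f x else 0)"
      by (rule integral_spike[OF f'(2)]) (use that in \<open>auto simp: f'(3) indicator_def\<close>)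
    also have "\<dots> = integral {t..b} f" by (rule Henstock_Kurzweil_Integration.integral_restrict_UNIV)
    finally show ?thesis by (simp add: k')
  qed
  have "integral {a..b} (\<lambda>x. f x * integral {a..x} g)
      = integral UNIV (\<lambda>x. if x \<in> {a..b} then f x * integral {a..x} g else 0)"
    by (rule Henstock_Kurzweil_Integration.integral_restrict_UNIV[symmetric])
  also have "\<dots> = integral UNIV (\<lambda>x. LINT t|lborel. k x t)"
  proof (rule integral_spike[OF f'(2)])
    show "(LINT t|lborel. k x t) = (if x \<in> {a..b} then f x * integral {a..x} g else 0)" if "x \<in> UNIV - M" for x
      using that by (cases "x \<in> {a..b}") (simp add: G f'(3), auto simp: k_def f'(3))
  qed
  also have "\<dots> = (LINT x|lborel. LINT t|lborel. k x t)"
    by (rule integral_lborel[OF lborel_pair.integrable_fst[OF ik]])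
  also have "\<dots> = (LINT t|lborel. LINT x|lborel. k x t)"
    by (rule lborel_pair.Fubini_integral[OF ik, symmetric])
  also have "\<dots> = integral UNIV (\<lambda>t. LINT x|lborel. k x t)"
    by (rule integral_lborel[OF lborel_pair.integrable_snd[OF ik], symmetric])
  also have "\<dots> = integral UNIV (\<lambda>t. if t \<in> {a..b} then g t * integral {t..b} f else 0)"
  proof (rule integral_spike[OF g'(2)])
    show "(if t \<in> {a..b} then g t * integral {t..b} f else 0) = (LINT x|lborel. k x t)" if "t \<in> UNIV - N" for t
      using that by (cases "t \<in> {a..b}") (simp add: F g'(3), auto simp: k' g'(3))
  qed
  also have "\<dots> = integral {a..b} (\<lambda>t. g t * integral {t..b} f)"
    by (rule Henstock_Kurzweil_Integration.integral_restrict_UNIV)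
  finally show ?thesis .
qed

section \<open>Weak derivatives on an interval\<close>

text \<open>The primitive vanishes to the left of the support of \<psi>, and mean zero makes it
  vanish again to the right; continuity of \<psi> makes it \<open>C1\<close>. Thus every such \<psi>
  is the derivative of an admissible test function.\<close>

lemma antiderivative_test_function:
  fixes \<psi> :: "real \<Rightarrow> real"
  assumes "a \<le> b" and cont: "continuous_on UNIV \<psi>" and ab: "a < \<alpha>" "\<beta> < b"
    and supp: "\<And>x. x \<notin> {\<alpha>..\<beta>} \<Longrightarrow> \<psi> x = 0" and mean: "integral {a..b} \<psi> = 0"
  shows "(\<lambda>x. integral {a..x} \<psi>) \<in> test_functions {a<..<b}"
    and "deriv (\<lambda>x. integral {a..x} \<psi>) = \<psi>"
proof -
  define \<phi> where "\<phi> x = integral {a..x} \<psi>" for x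
  have int: "\<psi> integrable_on {x..y}" for x y
    using cont by (auto intro: integrable_continuous_real continuous_on_subset)
  have zero: "integral {x..y} \<psi> = 0" if "y < \<alpha> \<or> \<beta> < x" for x y
    using that supp by (intro integral_unique has_integral_is_0) auto
  have low: "\<phi> x = 0" if "x < \<alpha>" for x
    using zero that by (simp add: \<phi>_def)
  \<comment> \<open>Up to \<open>b\<close>, subtract the vanishing integral over
    \<open>{x..b}\<close> from the full one; beyond \<open>b\<close>, add the vanishing integral
    over \<open>{b..x}\<close>. For \<open>x < a\<close> the interval \<open>{a..x}\<close> is
    empty.\<close>
  have high: "\<phi> x = 0" if "\<beta> < x" for x
  proof (cases "x < a")
    case False
    show ?thesis
    proof (cases "x \<le> b")
      case True
      then show ?thesis
        using Henstock_Kurzweil_Integration.integral_combine[of a x b \<psi>] False int zero[of b x] that mean by (simp add: \<phi>_def)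
    next
      case F2: False
      then show ?thesis
        using \<open>a \<le> b\<close> Henstock_Kurzweil_Integration.integral_combine[of a b x \<psi>] F2 int zero[of x b] ab mean by (simp add: \<phi>_def)
    qed
  qed (simp add: \<phi>_def)
  have der: "(\<phi> has_vector_derivative \<psi> x) (at x)" for x
  \<comment> \<open>At and left of \<open>a\<close> the fundamental theorem gives no two-sided
    derivative, but \<phi> is zero on the neighbourhood \<open>{..<\<alpha>}\<close>. Elsewhere
    \<open>x\<close> is interior to \<open>{a..x+1}\<close>.\<close>
  proof (cases "x \<le> a")
    case True
    have "((\<lambda>_. 0) has_vector_derivative 0) (at x)" by simp
    then have "(\<phi> has_vector_derivative 0) (at x)"
      by (rule has_vector_derivative_transform_within_open[of _ _ _ "{..<\<alpha>}"])
        (use True ab low in auto)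
    then show ?thesis using supp[of x] True ab by simp
  next
    case False
    have "(\<phi> has_vector_derivative \<psi> x) (at x within {a..x+1})"
      unfolding \<phi>_def by (rule integral_has_vector_derivative)
        (use False cont in \<open>auto intro: continuous_on_subset\<close>)
    then show ?thesis using False by (simp add: at_within_Icc_at)
  qed
  have *: "{x. \<phi> x \<noteq> 0} \<subseteq> {\<alpha>..\<beta>}"
    using low high by (auto simp: not_less[symmetric])
  then have "closure {x. \<phi> x \<noteq> 0} \<subseteq> {\<alpha>..\<beta>}"
    by (simp add: closure_minimal)
  moreover from * have "compact (closure {x. \<phi> x \<noteq> 0})"
    by (simp add: compact_closure bounded_subset[OF bounded_closed_interval])
  moreover have "\<phi> C1_differentiable_on UNIV"
    unfolding C1_differentiable_on_def using der cont by blast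
  ultimately have "\<phi> \<in> test_functions {a<..<b}"
    using ab by (force simp: test_functions_def)
  then show "(\<lambda>x. integral {a..x} \<psi>) \<in> test_functions {a<..<b}"
    by (simp add: \<phi>_def[abs_def])
  have "deriv \<phi> = \<psi>"
    using der by (intro ext DERIV_imp_deriv) (simp add: has_real_derivative_iff_has_vector_derivative)
  then show "deriv (\<lambda>x. integral {a..x} \<psi>) = \<psi>"
    by (simp add: \<phi>_def[abs_def])
qed

text \<open>Integrability of \<open>f\<close> matters only where \<psi> can be nonzero, so a locally
  integrable function can be paired with \<psi> over the whole interval.\<close>

lemma absolutely_integrable_mult_compact_support:
  fixes f \<psi> :: "real \<Rightarrow> real"
  assumes f: "f absolutely_integrable_on {\<alpha>..\<beta>}" and S: "{\<alpha>..\<beta>} \<subseteq> S"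
    and cont: "continuous_on UNIV \<psi>" and supp: "\<And>x. x \<notin> {\<alpha>..\<beta>} \<Longrightarrow> \<psi> x = 0"
  shows "(\<lambda>x. f x * \<psi> x) absolutely_integrable_on S"
proof -
  have c: "continuous_on {\<alpha>..\<beta>} \<psi>" using cont by (rule continuous_on_subset) simp
  have "(\<lambda>x. \<psi> x * f x) absolutely_integrable_on {\<alpha>..\<beta>}"
    by (rule absolutely_integrable_bounded_measurable_product_real)
      (use f c in \<open>auto intro: continuous_imp_measurable_on_sets_lebesgue compact_imp_bounded compact_continuous_image\<close>)
  then have "(\<lambda>x. if x \<in> {\<alpha>..\<beta>} then \<psi> x * f x else 0) absolutely_integrable_on UNIV"
    by (simp only: absolutely_integrable_restrict_UNIV)
  also have "(\<lambda>x. if x \<in> {\<alpha>..\<beta>} then \<psi> x * f x else 0) = (\<lambda>x. if x \<in> S then f x * \<psi> x else 0)"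
    using S supp by (auto simp: fun_eq_iff)
  finally show ?thesis
    by (simp only: absolutely_integrable_restrict_UNIV)
qed

lemma LINT_lebesgue_on_greaterThanLessThan:
  fixes f :: "real \<Rightarrow> real"
  assumes "f absolutely_integrable_on {a<..<b}"
  shows "(LINT x|lebesgue_on {a<..<b}. f x) = integral {a..b} f"
  using lebesgue_integral_eq_integral[OF absolutely_integrable_imp_integrable[OF assms]]
  by (simp add: integral_open_interval_real)

text \<open>Testing the weak derivative against the primitive \<phi> of \<psi> turns the integral of
  \<open>f * \<psi>\<close> into minus that of \<open>h * \<phi>\<close>; the triangle swap then
  moves the integration from \<psi> onto \<open>h\<close>.\<close>

lemma weak_derivative_minus_primitive:
  fixes f h \<psi> :: "real \<Rightarrow> real"
  assumes "a \<le> b" and weak: "has_weak_derivative_on f h {a<..<b}"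
    and h: "h absolutely_integrable_on {a..b}"
    and cont: "continuous_on UNIV \<psi>" and ab: "a < \<alpha>" "\<beta> < b"
    and supp: "\<And>x. x \<notin> {\<alpha>..\<beta>} \<Longrightarrow> \<psi> x = 0" and mean: "integral {a..b} \<psi> = 0"
  shows "integral {a..b} (\<lambda>x. (f x - integral {a..x} h) * \<psi> x) = 0"
proof -
  define \<phi> where "\<phi> x = integral {a..x} \<psi>" for x
  have sub: "{\<alpha>..\<beta>} \<subseteq> {a..b}" "{\<alpha>..\<beta>} \<subseteq> {a<..<b}" using ab by auto
  have conti: "continuous_on A \<psi>" for A using cont by (rule continuous_on_subset) simp
  have \<psi>: "\<psi> absolutely_integrable_on {a..b}"
    by (rule absolutely_integrable_continuous_real[OF conti])
  have H: "continuous_on {a..b} (\<lambda>x. integral {a..x} h)"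
    by (rule indefinite_integral_continuous_1) (use h in \<open>simp add: absolutely_integrable_on_def\<close>)
  have f: "f absolutely_integrable_on {\<alpha>..\<beta>}"
    using weak sub by (simp add: has_weak_derivative_on_def locally_integrable_on_def)
  have f\<psi>: "(\<lambda>x. f x * \<psi> x) absolutely_integrable_on {a<..<b}"
    "(\<lambda>x. f x * \<psi> x) absolutely_integrable_on {a..b}"
    using absolutely_integrable_mult_compact_support[OF f _ cont supp] sub by blast+
  have \<phi>c: "continuous_on {a..b} \<phi>"
    unfolding \<phi>_def by (rule indefinite_integral_continuous_1) (rule integrable_continuous_real[OF conti])
  have "(\<lambda>x. \<phi> x * h x) absolutely_integrable_on {a..b}"
    by (rule absolutely_integrable_bounded_measurable_product_real)
      (use h \<phi>c in \<open>auto intro: continuous_imp_measurable_on_sets_lebesgue compact_imp_bounded compact_continuous_image\<close>)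
  then have h\<phi>: "(\<lambda>x. h x * \<phi> x) absolutely_integrable_on {a<..<b}"
    using absolutely_integrable_on_open_interval[of a b "\<lambda>x. h x * \<phi> x"] by (simp add: mult.commute)
  have "(LINT x|lebesgue_on {a<..<b}. f x * \<psi> x) = - (LINT x|lebesgue_on {a<..<b}. h x * \<phi> x)"
    using weak antiderivative_test_function[OF \<open>a \<le> b\<close> cont ab supp mean]
    unfolding has_weak_derivative_on_def \<phi>_def by metis
  then have 1: "integral {a..b} (\<lambda>x. f x * \<psi> x) = - integral {a..b} (\<lambda>x. h x * \<phi> x)"
    by (simp add: LINT_lebesgue_on_greaterThanLessThan f\<psi> h\<phi>)
  \<comment> \<open>Mean zero converts the integral from \<open>a\<close> to \<open>t\<close> into
    one from \<open>t\<close> to \<open>b\<close>, the form that the swap produces.\<close>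
  have "integral {t..b} \<psi> = - \<phi> t" if "t \<in> {a..b}" for t
    using Henstock_Kurzweil_Integration.integral_combine[of a t b \<psi>] that mean integrable_continuous_real[OF conti] by (simp add: \<phi>_def)
  then have "integral {a..b} (\<lambda>x. h x * \<phi> x) = - integral {a..b} (\<lambda>x. h x * integral {x..b} \<psi>)"
    unfolding integral_neg[symmetric] by (intro integral_cong) simp
  also have "\<dots> = - integral {a..b} (\<lambda>x. \<psi> x * integral {a..x} h)"
    using integral_triangle_swap[OF \<psi> h] by simp
  finally have 2: "integral {a..b} (\<lambda>x. f x * \<psi> x) = integral {a..b} (\<lambda>x. \<psi> x * integral {a..x} h)"
    using 1 by simp
  have "integral {a..b} (\<lambda>x. (f x - integral {a..x} h) * \<psi> x)
      = integral {a..b} (\<lambda>x. f x * \<psi> x - \<psi> x * integral {a..x} h)"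
    by (simp add: algebra_simps)
  also have "\<dots> = integral {a..b} (\<lambda>x. f x * \<psi> x) - integral {a..b} (\<lambda>x. \<psi> x * integral {a..x} h)"
    by (rule integral_diff)
      (use f\<psi> conti H in \<open>auto simp: absolutely_integrable_on_def intro!: integrable_continuous_real continuous_intros\<close>)
  finally show ?thesis using 2 by simp
qed

text \<open>A function orthogonal to all continuous functions with compact support and mean zero is
  orthogonal, up to a constant \<open>c\<close>, to all continuous functions with compact support. These
  include truncated continuous approximations of the sign of \<open>F - c\<close>, times a cutoff.\<close>

lemma du_bois_reymond:
  fixes F :: "real \<Rightarrow> real"
  assumes ab: "a < b" and loc: "locally_integrable_on F {a<..<b}"
    and orth: "\<And>\<psi> \<alpha> \<beta>. \<lbrakk>continuous_on UNIV \<psi>; a < \<alpha>; \<beta> < b; \<And>x. x \<notin> {\<alpha>..\<beta>} \<Longrightarrow> \<psi> x = 0;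
        integral {a..b} \<psi> = 0\<rbrakk> \<Longrightarrow> integral {a..b} (\<lambda>x. F x * \<psi> x) = 0"
  obtains c where "AE x in lebesgue_on {a<..<b}. F x = c"
proof -
  have conti: "continuous_on A \<psi>" if "continuous_on UNIV \<psi>" for A and \<psi> :: "real \<Rightarrow> real"
    using that by (rule continuous_on_subset) simp
  have Fint: "(\<lambda>x. F x * \<psi> x) absolutely_integrable_on {a..b}"
    if "continuous_on UNIV \<psi>" "a < \<alpha>" "\<beta> < b" "\<And>x. x \<notin> {\<alpha>..\<beta>} \<Longrightarrow> \<psi> x = 0" for \<psi> \<alpha> \<beta>
  proof (rule absolutely_integrable_mult_compact_support[OF _ _ that(1,4)])
    show "F absolutely_integrable_on {\<alpha>..\<beta>}"
      using loc that(2,3) greaterThanLessThan_subseteq_greaterThanLessThan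
      by (simp add: locally_integrable_on_def subset_iff)
  qed (use that in auto)
  \<comment> \<open>A continuous tent, positive exactly on the open interval from a + \<delta> to b
    - \<delta>; it is identically zero if \<delta> is too large.\<close>
  define \<eta> where "\<eta> \<delta> x = max 0 (min (x - a - \<delta>) (b - \<delta> - x))" for \<delta> x
  have \<eta>c: "continuous_on UNIV (\<eta> \<delta>)" for \<delta>
    unfolding \<eta>_def by (intro continuous_intros)
  have \<eta>0: "\<eta> \<delta> x = 0" if "x \<notin> {a+\<delta>..b-\<delta>}" for x \<delta>
    using that by (auto simp: \<eta>_def)
  have F\<eta>: "(\<lambda>x. F x * \<eta> \<delta> x) absolutely_integrable_on {a..b}" if "\<delta> > 0" for \<delta>
    by (rule Fint[OF \<eta>c _ _ \<eta>0]) (use that in auto)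
  \<comment> \<open>A quarter of the length keeps the tent positive at the midpoint, so that its
    integral \<open>I\<close> is nonzero and can be divided by.\<close>
  define d where "d = (b - a) / 4"
  have d: "d > 0" using ab by (simp add: d_def)
  define I where "I = integral {a..b} (\<eta> d)"
  have "I \<noteq> 0"
  proof
    assume "I = 0"
    then have "\<forall>x\<in>{a..b}. \<eta> d x = 0"
      unfolding I_def using ab by (subst (asm) integral_eq_0_iff[OF conti[OF \<eta>c]]) (auto simp: \<eta>_def)
    moreover have "(a + b) / 2 \<in> {a..b}" "\<eta> d ((a+b)/2) > 0"
      using ab by (auto simp: \<eta>_def d_def field_simps)
    ultimately show False by force
  qed
  \<comment> \<open>The mean of \<open>F\<close> with weight \<open>\<eta> d\<close>. Subtracting
    \<open>J / I * \<eta> d\<close> from any admissible \<psi> with integral \<open>J\<close> gives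
    mean zero, and the orthogonality hypothesis then says that the integral of
    \<open>F * \<psi>\<close> is \<open>c * J\<close>.\<close>
  define c where "c = integral {a..b} (\<lambda>x. F x * \<eta> d x) / I"
  have orth': "integral {a..b} (\<lambda>x. (F x - c) * \<psi> x) = 0"
    if \<psi>: "continuous_on UNIV \<psi>" "a < \<alpha>" "\<beta> < b" "\<And>x. x \<notin> {\<alpha>..\<beta>} \<Longrightarrow> \<psi> x = 0" for \<psi> \<alpha> \<beta>
  proof -
    define J where "J = integral {a..b} \<psi>"
    note int = integrable_continuous_real[OF conti]
    have i\<eta>: "(\<lambda>x. F x * \<eta> d x) integrable_on {a..b}" "(\<lambda>x. F x * \<psi> x) integrable_on {a..b}"
      using F\<eta>[OF d] Fint[OF \<psi>] by (auto simp: absolutely_integrable_on_def)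
    have "integral {a..b} (\<lambda>x. F x * (\<psi> x - J / I * \<eta> d x)) = 0"
    proof (rule orth)
      show "continuous_on UNIV (\<lambda>x. \<psi> x - J / I * \<eta> d x)"
        by (intro continuous_intros \<psi> \<eta>c)
      show "a < min \<alpha> (a + d)" "max \<beta> (b - d) < b" using \<psi> d by auto
      show "\<psi> x - J / I * \<eta> d x = 0" if "x \<notin> {min \<alpha> (a + d)..max \<beta> (b - d)}" for x
      proof -
        have "x \<notin> {\<alpha>..\<beta>}" "x \<notin> {a + d..b - d}" using that by auto
        then show ?thesis by (simp add: \<psi>(4) \<eta>0)
      qed
      have "integral {a..b} (\<lambda>x. \<psi> x - J / I * \<eta> d x) = integral {a..b} \<psi> - integral {a..b} (\<lambda>x. J / I * \<eta> d x)"
        by (rule integral_diff) (use \<open>I \<noteq> 0\<close> in \<open>auto intro!: int \<psi> \<eta>c continuous_intros\<close>)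
      then show "integral {a..b} (\<lambda>x. \<psi> x - J / I * \<eta> d x) = 0"
        using \<open>I \<noteq> 0\<close> by (simp add: J_def[symmetric] I_def[symmetric])
    qed
    also have "(\<lambda>x. F x * (\<psi> x - J / I * \<eta> d x)) = (\<lambda>x. F x * \<psi> x - J / I * (F x * \<eta> d x))"
      by (simp add: algebra_simps)
    also have "integral {a..b} \<dots> = integral {a..b} (\<lambda>x. F x * \<psi> x) - integral {a..b} (\<lambda>x. J / I * (F x * \<eta> d x))"
      using integrable_cmul[OF i\<eta>(1), of "J / I"] i\<eta>(2) by (intro integral_diff) auto
    also have "integral {a..b} (\<lambda>x. J / I * (F x * \<eta> d x)) = J * c"
      unfolding Henstock_Kurzweil_Integration.integral_mult_right by (simp add: c_def)
    finally have "integral {a..b} (\<lambda>x. F x * \<psi> x) = c * J" by simp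
    moreover have "integral {a..b} (\<lambda>x. (F x - c) * \<psi> x) = integral {a..b} (\<lambda>x. F x * \<psi> x) - c * J"
      unfolding J_def left_diff_distrib
      by (subst integral_diff) (auto intro!: i\<eta> int \<psi> continuous_intros)
    ultimately show ?thesis by simp
  qed
  have cutoff: "AE x in lebesgue_on {a..b}. (F x - c) * \<eta> \<delta> x = 0" if "\<delta> > 0" for \<delta>
  proof -
    define P where "P x = (F x - c) * \<eta> \<delta> x" for x
    have P: "P absolutely_integrable_on {a..b}"
      unfolding P_def left_diff_distrib
      by (intro set_integral_diff(1) F\<eta> that absolutely_integrable_continuous_real
          continuous_intros conti[OF \<eta>c])
    then have Pi: "integrable (lebesgue_on {a..b}) P"
      by (rule absolutely_integrable_imp_integrable) simp
    have "(\<lambda>x. if x \<in> {a..b} then P x else 0) \<in> borel_measurable lebesgue"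
      by (rule borel_measurable_if_I) (use Pi in auto)
    \<comment> \<open>Lebesgue measurability yields continuous functions that converge to the sign
      of \<open>P\<close> off a negligible set.\<close>
    then have "(\<lambda>x. sgn (if x \<in> {a..b} then P x else 0)) measurable_on UNIV"
      by (intro lebesgue_measurable_imp_measurable_on) auto
    then obtain N g where N: "negligible N" and g: "\<And>n. continuous_on UNIV (g n)"
      and lim: "\<And>x. x \<notin> N \<Longrightarrow> (\<lambda>n. g n x) \<longlonglongrightarrow> sgn (if x \<in> {a..b} then P x else 0)"
      unfolding measurable_on_def by auto
    \<comment> \<open>Truncation to [-1, 1] keeps the limit, whose values lie there already, and
      makes the absolute value of \<open>P\<close> a majorant for dominated convergence.\<close>
    define h where "h n x = max (-1) (min 1 (g n x))" for n x
    have hc: "continuous_on UNIV (h n)" for n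
      unfolding h_def by (intro continuous_intros g)
    have hm: "h n \<in> borel_measurable (lebesgue_on {a..b})" for n
      by (intro continuous_imp_measurable_on_sets_lebesgue conti[OF hc]) simp
    have h1: "\<bar>h n x\<bar> \<le> 1" for n x by (auto simp: h_def)
    have hlim: "(\<lambda>n. h n x) \<longlonglongrightarrow> sgn (P x)" if "x \<notin> N" "x \<in> {a..b}" for x
    proof -
      have "(\<lambda>n. h n x) \<longlonglongrightarrow> max (-1) (min 1 (sgn (P x)))"
        unfolding h_def using lim[OF that(1)] that(2) by (intro tendsto_intros) simp
      then show ?thesis by (simp add: sgn_if)
    qed
    have z: "(LINT x|lebesgue_on {a..b}. P x * h n x) = 0" for n
    proof -
      have "(LINT x|lebesgue_on {a..b}. P x * h n x) = integral {a..b} (\<lambda>x. P x * h n x)"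
      proof (rule lebesgue_integral_eq_integral)
        show "integrable (lebesgue_on {a..b}) (\<lambda>x. P x * h n x)"
          by (rule Bochner_Integration.integrable_bound[OF Pi])
            (use Pi hm h1 in \<open>auto simp: abs_mult intro!: mult_left_le\<close>)
      qed simp
      \<comment> \<open>Regrouping puts the cutoff with \<open>h n\<close>: their product is
        continuous with support inside the open interval, as orthogonality requires.\<close>
      also have "\<dots> = integral {a..b} (\<lambda>x. (F x - c) * (\<eta> \<delta> x * h n x))"
        by (simp add: P_def mult.assoc)
      also have "\<dots> = 0"
        by (rule orth'[of _ "a + \<delta>" "b - \<delta>"]) (use that \<eta>0 in \<open>auto intro!: continuous_intros \<eta>c hc\<close>)
      finally show ?thesis .
    qed
    have "(\<lambda>n. LINT x|lebesgue_on {a..b}. P x * h n x) \<longlonglongrightarrow> (LINT x|lebesgue_on {a..b}. P x * sgn (P x))"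
    proof (rule integral_dominated_convergence)
      show "integrable (lebesgue_on {a..b}) (\<lambda>x. \<bar>P x\<bar>)" using Pi by simp
      show "AE x in lebesgue_on {a..b}. norm (P x * h n x) \<le> \<bar>P x\<bar>" for n
        using h1 by (auto simp: abs_mult intro!: mult_left_le)
      have "AE x in lebesgue. x \<notin> N"
        using N by (simp add: negligible_iff_null_sets AE_not_in)
      then have "AE x in lebesgue_on {a..b}. x \<notin> N"
        by (subst AE_restrict_space_iff) auto
      then show "AE x in lebesgue_on {a..b}. (\<lambda>n. P x * h n x) \<longlonglongrightarrow> P x * sgn (P x)"
        by (rule AE_mp) (auto intro!: AE_I2 tendsto_intros hlim)
    qed (use Pi hm in auto)
    then have "(LINT x|lebesgue_on {a..b}. \<bar>P x\<bar>) = 0"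
      unfolding z by (simp add: abs_sgn LIMSEQ_const_iff)
    then have "AE x in lebesgue_on {a..b}. \<bar>P x\<bar> = 0"
      using integral_nonneg_eq_0_iff_AE[of "lebesgue_on {a..b}" "\<lambda>x. \<bar>P x\<bar>"] Pi by simp
    then show ?thesis by (simp add: P_def)
  qed
  \<comment> \<open>Countably many cutoffs keep the exceptional set null, and each interior point
    lies where one of them is positive.\<close>
  have "AE x in lebesgue_on {a..b}. \<forall>n. (F x - c) * \<eta> (1 / Suc n) x = 0"
    unfolding AE_all_countable using cutoff by simp
  then have "AE x in lebesgue. x \<in> {a..b} \<longrightarrow> (\<forall>n. (F x - c) * \<eta> (1 / Suc n) x = 0)"
    by (subst (asm) AE_restrict_space_iff) auto
  then have "AE x in lebesgue. x \<in> {a<..<b} \<longrightarrow> F x = c"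
  proof (rule AE_mp, intro AE_I2 impI)
    fix x assume *: "x \<in> {a..b} \<longrightarrow> (\<forall>n. (F x - c) * \<eta> (1 / Suc n) x = 0)" and x: "x \<in> {a<..<b}"
    then obtain n where "inverse (of_nat (Suc n)) < min (x - a) (b - x)"
      using reals_Archimedean[of "min (x - a) (b - x)"] by auto
    then have "\<eta> (1 / Suc n) x > 0" by (auto simp: \<eta>_def inverse_eq_divide)
    moreover have "(F x - c) * \<eta> (1 / Suc n) x = 0" using * x by auto
    ultimately show "F x = c" by simp
  qed
  then have "AE x in lebesgue_on {a<..<b}. F x = c"
    by (subst AE_restrict_space_iff) auto
  then show ?thesis by (rule that)
qed

text \<open>The difference of \<open>f\<close> and the primitive of \<open>h\<close> meets the
  hypotheses of \<open>du_bois_reymond\<close>. It is applied once to the signed power of the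
  derivative and once to the solution itself.\<close>

lemma weak_derivative_eq_primitive:
  fixes f h :: "real \<Rightarrow> real"
  assumes ab: "a < b" and weak: "has_weak_derivative_on f h {a<..<b}"
    and h: "h absolutely_integrable_on {a..b}"
  obtains c where "AE x in lebesgue_on {a<..<b}. f x = c + integral {a..x} h"
proof -
  have H: "continuous_on {a..b} (\<lambda>x. integral {a..x} h)"
    by (rule indefinite_integral_continuous_1) (use h in \<open>simp add: absolutely_integrable_on_def\<close>)
  have "locally_integrable_on (\<lambda>x. f x - integral {a..x} h) {a<..<b}"
    unfolding locally_integrable_on_def
  proof (intro allI impI)
    fix K assume K: "compact K \<and> K \<subseteq> {a<..<b}"
    then have "f absolutely_integrable_on K"
      using weak by (simp add: has_weak_derivative_on_def locally_integrable_on_def)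
    moreover have "(\<lambda>x. integral {a..x} h) absolutely_integrable_on K"
      by (rule set_integrable_subset[OF absolutely_integrable_continuous_real[OF H]])
        (use K in \<open>auto dest: compact_imp_closed\<close>)
    ultimately show "(\<lambda>x. f x - integral {a..x} h) absolutely_integrable_on K"
      by (rule set_integral_diff(1))
  qed
  moreover have "integral {a..b} (\<lambda>x. (f x - integral {a..x} h) * \<psi> x) = 0"
    if "continuous_on UNIV \<psi>" "a < \<alpha>" "\<beta> < b" "\<And>x. x \<notin> {\<alpha>..\<beta>} \<Longrightarrow> \<psi> x = 0"
      "integral {a..b} \<psi> = 0" for \<psi> \<alpha> \<beta>
    by (rule weak_derivative_minus_primitive[OF less_imp_le[OF ab] weak h that])
  ultimately obtain c where "AE x in lebesgue_on {a<..<b}. f x - integral {a..x} h = c"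
    by (rule du_bois_reymond[OF ab])
  then have "AE x in lebesgue_on {a<..<b}. f x = c + integral {a..x} h"
    by (rule AE_mp) (auto intro!: AE_I2)
  then show ?thesis by (rule that)
qed

section \<open>Continuity estimates for the signed power\<close>

lemma spow_eq_sgn: "spow z a = sgn z * \<bar>z\<bar> powr a"
  by (cases "z = 0") (auto simp: spow_def powr_diff sgn_if)

lemma spow_spow_inverse:
  assumes "q > 0"
  shows "spow (spow z q) (1 / q) = z"
  using assms by (simp add: spow_eq_sgn sgn_mult abs_mult powr_powr sgn_mult_abs abs_sgn_eq)

lemma continuous_on_spow [continuous_intros]:
  assumes "continuous_on S f" "r > 0"
  shows "continuous_on S (\<lambda>x. spow (f x) r)"
proof -
  \<comment> \<open>Splitting into positive and negative parts leaves nonnegative bases, for which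
    \<open>powr\<close> with a positive exponent is continuous even at zero.\<close>
  have eq: "(\<lambda>x. spow (f x) r) = (\<lambda>x. max 0 (f x) powr r - max 0 (- f x) powr r)"
    by (auto simp: spow_eq_sgn sgn_if max_def fun_eq_iff)
  show ?thesis unfolding eq
    using assms by (intro continuous_intros continuous_on_powr') auto
qed

text \<open>Subadditivity of the concave power: after division by \<open>x\<close>, the numbers
  \<open>y / x\<close> and \<open>(x - y) / x\<close> lie in [0, 1] and add up to 1, and there t
  \<le> \<open>t powr r\<close>.\<close>

lemma powr_diff_le_powr_of_diff:
  fixes x y r :: real
  assumes "0 \<le> y" "y \<le> x" "0 < r" "r \<le> 1"
  shows "x powr r - y powr r \<le> (x - y) powr r"
proof (cases "x = 0")
  case False
  then have x: "x > 0" using assms by simp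
  have *: "t \<le> t powr r" if "0 \<le> t" "t \<le> 1" for t :: real
    using powr_mono'[of r 1 t] that assms by (cases "t = 0") auto
  have "1 = y / x + (x - y) / x" using x by (simp add: field_simps)
  also have "\<dots> \<le> (y / x) powr r + ((x - y) / x) powr r"
    using assms x by (intro add_mono *) auto
  also have "\<dots> = (y powr r + (x - y) powr r) / x powr r"
    using assms x by (simp add: powr_divide add_divide_distrib)
  finally show ?thesis using x by (simp add: field_simps)
qed (use assms in auto)

text \<open>Mean value theorem; the intermediate point is strictly positive, so the power is
  differentiable there even when \<open>y = 0\<close>.\<close>

lemma powr_diff_le_linear:
  fixes x y r M :: real
  assumes "0 \<le> y" "y \<le> x" "x \<le> M" "1 \<le> r"
  shows "x powr r - y powr r \<le> r * M powr (r - 1) * (x - y)"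
proof (cases "y = x")
  case False
  then have "y < x" using assms by simp
  moreover have "continuous_on {y..x} (\<lambda>t. t powr r)"
    using assms by (intro continuous_on_powr') (auto intro: continuous_intros)
  moreover have "((\<lambda>t. t powr r) has_real_derivative r * t powr (r - 1)) (at t)" if "y < t" for t
    using that assms by (intro has_real_derivative_powr) auto
  ultimately obtain z where z: "y < z" "z < x" and eq: "x powr r - y powr r = r * z powr (r - 1) * (x - y)"
    using mvt[of y x "\<lambda>t. t powr r" "\<lambda>t s. r * t powr (r - 1) * s"]
    by (auto simp: has_field_derivative_def)
  have "z powr (r - 1) \<le> M powr (r - 1)"
    using z assms by (intro powr_mono2) auto
  then show ?thesis unfolding eq
    using assms by (intro mult_right_mono mult_left_mono) auto
qed simp

text \<open>For equal signs subadditivity gives the bound even with constant 1. For opposite signs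
  both absolute values are at most that of \<open>a - b\<close>, which costs the factor 2.\<close>

lemma spow_diff_Holder:
  assumes "0 < r" "r \<le> 1"
  shows "\<bar>spow a r - spow b r\<bar> \<le> 2 * \<bar>a - b\<bar> powr r"
proof (induction a b rule: linorder_wlog)
  case (le a b)
  consider "0 \<le> a" | "b \<le> 0" | "a < 0" "0 < b" by linarith
  then show ?case
  proof cases
    case 1
    have "a powr r \<le> b powr r" using 1 le assms by (intro powr_mono2) auto
    moreover have "0 \<le> (b - a) powr r" by simp
    ultimately show ?thesis
      using powr_diff_le_powr_of_diff[of a b r] 1 le assms by (auto simp: spow_eq_sgn sgn_if)
  next
    case 2
    have "(- b) powr r \<le> (- a) powr r" using 2 le assms by (intro powr_mono2) auto
    moreover have "0 \<le> (b - a) powr r" by simp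
    ultimately show ?thesis
      using powr_diff_le_powr_of_diff[of "-b" "-a" r] 2 le assms by (auto simp: spow_eq_sgn sgn_if)
  next
    case 3
    have "(- a) powr r \<le> (b - a) powr r" "b powr r \<le> (b - a) powr r"
      using 3 assms by (auto intro!: powr_mono2)
    moreover have "spow a r = - ((- a) powr r)" "spow b r = b powr r" and "\<bar>a - b\<bar> = b - a"
      using 3 by (auto simp: spow_eq_sgn)
    ultimately show ?thesis unfolding \<open>\<bar>a - b\<bar> = b - a\<close> using powr_ge_zero[of "- a" r] powr_ge_zero[of b r] by linarith
  qed
qed (simp add: abs_minus_commute)

text \<open>For opposite signs, compare each number with zero and add: the absolute values of
  \<open>a\<close> and \<open>b\<close> sum to that of \<open>a - b\<close>.\<close>

lemma spow_diff_Lipschitz: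
  assumes "1 \<le> r" "\<bar>a\<bar> \<le> M" "\<bar>b\<bar> \<le> M"
  shows "\<bar>spow a r - spow b r\<bar> \<le> r * M powr (r - 1) * \<bar>a - b\<bar>"
  using assms(2,3)
proof (induction a b rule: linorder_wlog)
  case (le a b)
  consider "0 \<le> a" | "b \<le> 0" | "a < 0" "0 < b" by linarith
  then show ?case
  proof cases
    case 1
    have "a powr r \<le> b powr r" using 1 le assms(1) by (intro powr_mono2) auto
    then show ?thesis
      using powr_diff_le_linear[of a b M r] 1 le assms(1) by (auto simp: spow_eq_sgn sgn_if)
  next
    case 2
    have "(- b) powr r \<le> (- a) powr r" using 2 le assms(1) by (intro powr_mono2) auto
    then show ?thesis
      using powr_diff_le_linear[of "-b" "-a" M r] 2 le assms(1) by (auto simp: spow_eq_sgn sgn_if)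
  next
    case 3
    have "(- a) powr r \<le> r * M powr (r - 1) * (- a)" "b powr r \<le> r * M powr (r - 1) * b"
      using powr_diff_le_linear[of 0 "-a" M r] powr_diff_le_linear[of 0 b M r] 3 le assms(1) by auto
    moreover have "spow a r = - ((- a) powr r)" "spow b r = b powr r"
      using 3 by (auto simp: spow_eq_sgn)
    ultimately have "\<bar>spow a r - spow b r\<bar> \<le> r * M powr (r - 1) * (- a) + r * M powr (r - 1) * b"
      using powr_ge_zero[of "- a" r] powr_ge_zero[of b r] by linarith
    also have "\<dots> = r * M powr (r - 1) * \<bar>a - b\<bar>" using 3 by (simp add: algebra_simps)
    finally show ?thesis .
  qed
qed (simp add: abs_minus_commute)

section \<open>The integral formula for solutions\<close>

lemma AE_lebesgue_on_obtain_negligible: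
  assumes "AE x in lebesgue_on S. P x" "S \<in> sets lebesgue"
  obtains N where "negligible N" "\<And>x. x \<in> S - N \<Longrightarrow> P x"
proof -
  have "AE x in lebesgue. x \<in> S \<longrightarrow> P x"
    using assms by (subst (asm) AE_restrict_space_iff) auto
  then obtain N where "N \<in> null_sets lebesgue" and sub: "{x \<in> space lebesgue. \<not> (x \<in> S \<longrightarrow> P x)} \<subseteq> N"
    unfolding eventually_ae_filter by auto
  moreover have "P x" if "x \<in> S - N" for x
    using subsetD[OF sub, of x] that by auto
  ultimately show ?thesis by (intro that[of N]) (auto simp: negligible_iff_null_sets)
qed

text \<open>Inside the interval the set of disagreement is open and negligible, hence empty; the
  endpoints follow by density.\<close>

lemma continuous_eq_off_negligible:
  fixes f g :: "real \<Rightarrow> real"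
  assumes "continuous_on {a..b} f" "continuous_on {a..b} g" "negligible N"
    and eq: "\<And>x. x \<in> {a<..<b} - N \<Longrightarrow> f x = g x" and "a < b" "x \<in> {a..b}"
  shows "f x = g x"
proof -
  let ?D = "{a<..<b} \<inter> (\<lambda>x. f x - g x) -` (- {0})"
  have "open ?D"
    using assms by (intro continuous_open_preimage continuous_intros)
      (auto elim!: continuous_on_subset)
  moreover have "negligible ?D"
    using \<open>negligible N\<close> by (rule negligible_subset) (use eq in auto)
  ultimately have "?D = {}" using open_not_negligible by blast
  then have "f y - g y = 0" if "y \<in> {a<..<b}" for y using that by blast
  moreover have "closure {a<..<b} = {a..b}" using \<open>a < b\<close> by (rule closure_greaterThanLessThan)
  ultimately have "f x - g x = 0"
    using continuous_constant_on_closure[of "{a<..<b}" "\<lambda>x. f x - g x" 0 x]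
      continuous_on_diff[OF assms(1,2)] assms(6) by simp
  then show ?thesis by simp
qed

text \<open>On a set of finite measure, \<open>1 + (g x)\<^sup>2\<close> is an integrable
  majorant.\<close>

lemma L2_space_absolutely_integrable:
  assumes "g \<in> L2_space {a<..<b}"
  shows "g absolutely_integrable_on {a<..<b}" "g absolutely_integrable_on {a..b}"
proof -
  have m: "g \<in> borel_measurable (lebesgue_on {a<..<b})"
    and i: "integrable (lebesgue_on {a<..<b}) (\<lambda>x. (g x)\<^sup>2)"
    using assms by (auto simp: L2_space_def)
  have "integrable (lebesgue_on {a<..<b}) (\<lambda>x. 1 + (g x)\<^sup>2)"
    using i by (intro Bochner_Integration.integrable_add finite_measure.integrable_const
        finite_measure_lebesgue_on) auto
  then have "integrable (lebesgue_on {a<..<b}) g"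
  proof (rule Bochner_Integration.integrable_bound[OF _ m], intro AE_I2)
    fix x
    have "2 * \<bar>g x\<bar> \<le> 1 + (g x)\<^sup>2"
      using sum_squares_bound[of 1 "\<bar>g x\<bar>"] by simp
    then show "norm (g x) \<le> norm (1 + (g x)\<^sup>2)" by simp
  qed
  then show "g absolutely_integrable_on {a<..<b}"
    by (simp add: set_integrable_def integrable_restrict_space)
  then show "g absolutely_integrable_on {a..b}"
    using absolutely_integrable_on_open_interval[of a b g] by simp
qed

text \<open>Integrate the equation once, invert the signed power to get the weak derivative
  \<open>v\<close>, and integrate again; \<open>u 0 = 0\<close> removes the second constant. The
  first constant \<open>c\<close> is what the condition at 1 constrains later.\<close>

lemma p_poisson_solution_integral_form:
  assumes p: "p > 1" and r: "r = 1 / (p - 1)" and g: "g \<in> L2_space unit_ivl"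
    and sol: "p_poisson_solution p g u"
  obtains c where "\<forall>x\<in>{0..1}. u x = integral {0..x} (\<lambda>t. spow (c + integral {0..t} g) r)"
proof -
  have r0: "r > 0" using p r by simp
  obtain v where u: "continuous_on {0..1} u" "u 0 = 0"
    and uv: "has_weak_derivative_on u v unit_ivl"
    and vg: "has_weak_derivative_on (\<lambda>x. spow (v x) (p - 1)) g unit_ivl"
    using sol by (auto simp: p_poisson_solution_def)
  note gi = L2_space_absolutely_integrable(2)[OF g]
  obtain c where "AE x in lebesgue_on unit_ivl. spow (v x) (p - 1) = c + integral {0..x} g"
    using weak_derivative_eq_primitive[OF zero_less_one vg gi] .
  then obtain N where N: "negligible N"
    "\<And>x. x \<in> unit_ivl - N \<Longrightarrow> spow (v x) (p - 1) = c + integral {0..x} g"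
    by (rule AE_lebesgue_on_obtain_negligible) auto
  define w where "w x = spow (c + integral {0..x} g) r" for x
  have wc: "continuous_on {0..1} w"
    unfolding w_def using gi r0
    by (intro continuous_intros indefinite_integral_continuous_1) (auto simp: absolutely_integrable_on_def)
  have vw: "v x = w x" if "x \<in> unit_ivl - N" for x
    using N(2)[OF that] spow_spow_inverse[of "p - 1" "v x"] p r by (simp add: w_def)
  \<comment> \<open>A weak derivative is a priori only locally integrable. Agreement with the
    continuous \<open>w\<close> makes \<open>v\<close> integrable up to the endpoints, so that it
    can be integrated from 0.\<close>
  have "w absolutely_integrable_on unit_ivl"
    using absolutely_integrable_continuous_real[OF wc] absolutely_integrable_on_open_interval[of 0 1 w] by simp
  then have "v absolutely_integrable_on unit_ivl"
    by (rule absolutely_integrable_spike[OF _ N(1)]) (rule vw)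
  then have vi: "v absolutely_integrable_on {0..1}"
    using absolutely_integrable_on_open_interval[of 0 1 v] by simp
  obtain k where "AE x in lebesgue_on unit_ivl. u x = k + integral {0..x} v"
    using weak_derivative_eq_primitive[OF zero_less_one uv vi] .
  then obtain M where M: "negligible M" "\<And>x. x \<in> unit_ivl - M \<Longrightarrow> u x = k + integral {0..x} v"
    by (rule AE_lebesgue_on_obtain_negligible) auto
  have vwi: "integral {0..x} v = integral {0..x} w" if "x \<le> 1" for x
    by (rule integral_spike[of "N \<union> {0, 1}"]) (use N(1) that vw in \<open>auto simp: negligible_Un\<close>)
  have "u x = k + integral {0..x} w" if "x \<in> {0..1}" for x
    by (rule continuous_eq_off_negligible[OF u(1) _ M(1) _ zero_less_one that])
      (use M(2) vwi wc in \<open>auto intro!: continuous_intros indefinite_integral_continuous_1 integrable_continuous_real\<close>)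
  moreover from this[of 0] u have "k = 0" by simp
  ultimately show ?thesis using that[of c] by (simp add: w_def[abs_def])
qed

section \<open>Distance of primitives and comparison of norms\<close>

text \<open>The primitive of \<open>f - g\<close> takes equal values at both ends, so its derivative
  vanishes somewhere in between.\<close>

lemma equal_integrals_imp_meet:
  fixes f g :: "real \<Rightarrow> real"
  assumes "a < b" "continuous_on {a..b} f" "continuous_on {a..b} g"
    and "integral {a..b} f = integral {a..b} g"
  obtains x where "x \<in> {a..b}" "f x = g x"
proof -
  let ?F = "\<lambda>x. integral {a..x} (\<lambda>t. f t - g t)"
  have c: "continuous_on {a..b} (\<lambda>t. f t - g t)" using assms by (intro continuous_intros)
  have "?F b - ?F a = 0"
    using assms by (simp add: integral_diff integrable_continuous_real)
  moreover obtain z where "a < z" "z < b" "?F b - ?F a = (f z - g z) * (b - a)"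
  proof (rule mvt[OF \<open>a < b\<close>])
    show "continuous_on {a..b} ?F"
      by (rule indefinite_integral_continuous_1[OF integrable_continuous_real[OF c]])
    show "(?F has_derivative (*) (f x - g x)) (at x)" if "a < x" "x < b" for x
      using integral_has_real_derivative[OF c, of x] that
      by (simp add: has_field_derivative_def at_within_Icc_at)
  qed
  ultimately show ?thesis using that[of z] \<open>a < b\<close> by simp
qed

lemma integral_increment_le_L1_norm:
  assumes h: "h absolutely_integrable_on {0..1}" and "x \<in> {0..1}" "y \<in> {0..1}"
  shows "\<bar>integral {0..x} h - integral {0..y} h\<bar> \<le> L1_norm unit_ivl h"
  using assms(2,3)
proof (induction x y rule: linorder_wlog)
  case (le x y)
  have hi: "h integrable_on {a..b}" "(\<lambda>x. \<bar>h x\<bar>) integrable_on {a..b}" if "0 \<le> a" "b \<le> 1" for a b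
    using absolutely_integrable_on_subinterval[OF h, of a b] that
    by (auto simp: absolutely_integrable_on_def)
  have "integral {0..x} h + integral {x..y} h = integral {0..y} h"
    by (rule Henstock_Kurzweil_Integration.integral_combine) (use le hi in auto)
  then have "\<bar>integral {0..x} h - integral {0..y} h\<bar> = \<bar>integral {x..y} h\<bar>" by simp
  also have "\<dots> \<le> integral {x..y} (\<lambda>x. \<bar>h x\<bar>)"
    using le integral_norm_bound_integral[of h "{x..y}" "\<lambda>x. \<bar>h x\<bar>"] hi by auto
  also have "\<dots> \<le> integral {0..1} (\<lambda>x. \<bar>h x\<bar>)"
    by (rule integral_subset_le) (use le hi in auto)
  also have "\<dots> = L1_norm unit_ivl h"
    unfolding L1_norm_def using h absolutely_integrable_on_open_interval[of 0 1 h]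
    by (subst LINT_lebesgue_on_greaterThanLessThan) (auto intro: set_integrable_abs)
  finally show ?case .
qed (simp add: abs_minus_commute)

text \<open>The two primitives agree somewhere, so their distance is an increment of the primitive of
  the difference. With \<open>h2 = 0\<close> and \<open>c2 = 0\<close> this bounds a single primitive.\<close>

lemma primitives_distance_le_L1_norm:
  assumes h: "h1 absolutely_integrable_on {0..1}" "h2 absolutely_integrable_on {0..1}"
    and r: "r > 0"
    and eq: "integral {0..1} (\<lambda>t. spow (c1 + integral {0..t} h1) r)
           = integral {0..1} (\<lambda>t. spow (c2 + integral {0..t} h2) r)"
    and x: "x \<in> {0..1}"
  shows "\<bar>(c1 + integral {0..x} h1) - (c2 + integral {0..x} h2)\<bar> \<le> L1_norm unit_ivl (\<lambda>x. h1 x - h2 x)"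
proof -
  have c: "continuous_on {0..1} (\<lambda>t. spow (c + integral {0..t} h) r)"
    if "h absolutely_integrable_on {0..1}" for c and h :: "real \<Rightarrow> real"
    using that r
    by (intro continuous_intros indefinite_integral_continuous_1) (auto simp: absolutely_integrable_on_def)
  obtain z where z: "z \<in> {0..1}" "spow (c1 + integral {0..z} h1) r = spow (c2 + integral {0..z} h2) r"
    using equal_integrals_imp_meet[OF zero_less_one c[OF h(1)] c[OF h(2)] eq] .
  \<comment> \<open>The signed power is injective, so the meeting point of the powers is one of the
    primitives.\<close>
  then have z': "c1 + integral {0..z} h1 = c2 + integral {0..z} h2"
    using r by (metis spow_spow_inverse)
  have d: "integral {0..y} (\<lambda>x. h1 x - h2 x) = integral {0..y} h1 - integral {0..y} h2" if "y \<in> {0..1}" for y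
    using h[THEN absolutely_integrable_on_subinterval, of 0 y] that
    by (intro integral_diff) (auto simp: absolutely_integrable_on_def)
  have "(\<lambda>x. h1 x - h2 x) absolutely_integrable_on {0..1}"
    using h by (rule set_integral_diff(1))
  from integral_increment_le_L1_norm[OF this x z(1)] show ?thesis
    using d[OF x] d[OF z(1)] z' by (simp add: algebra_simps)
qed

lemma L2_norm_le_bound:
  assumes f: "continuous_on {0..1} f" and b: "\<And>x. x \<in> {0..1} \<Longrightarrow> \<bar>f x\<bar> \<le> C"
  shows "L2_norm unit_ivl f \<le> C"
proof -
  have C: "0 \<le> C" using b[of 0] by simp
  have "(\<lambda>x. (f x)\<^sup>2) absolutely_integrable_on unit_ivl"
    using absolutely_integrable_on_open_interval[of 0 1 "\<lambda>x. (f x)\<^sup>2"] f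
    by (simp add: absolutely_integrable_continuous_real continuous_intros)
  then have "(LINT x|lebesgue_on unit_ivl. (f x)\<^sup>2) = integral {0..1} (\<lambda>x. (f x)\<^sup>2)"
    by (rule LINT_lebesgue_on_greaterThanLessThan)
  also have "\<dots> \<le> C\<^sup>2"
  proof -
    have "norm (integral {0..1} (\<lambda>x. (f x)\<^sup>2)) \<le> C\<^sup>2 * (1 - 0)"
    proof (rule integral_bound)
      show "norm ((f x)\<^sup>2) \<le> C\<^sup>2" if "x \<in> {0..1}" for x
        using power_mono[OF b[OF that], of 2] by simp
    qed (use f in \<open>auto intro!: continuous_intros\<close>)
    then show ?thesis by simp
  qed
  finally show ?thesis unfolding L2_norm_def
    using C by (intro real_le_lsqrt) auto
qed

text \<open>The interval has length 1, so \<open>d\<close> is the mean of the absolute value of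
  \<open>f\<close>, and the claim is that its variance is nonnegative.\<close>

lemma L1_norm_le_L2_norm:
  assumes "f \<in> borel_measurable (lebesgue_on unit_ivl)" "f absolutely_integrable_on unit_ivl"
    and i2: "integrable (lebesgue_on unit_ivl) (\<lambda>x. (f x)\<^sup>2)"
  shows "L1_norm unit_ivl f \<le> L2_norm unit_ivl f"
proof -
  define d where "d = L1_norm unit_ivl f"
  have i1: "integrable (lebesgue_on unit_ivl) (\<lambda>x. \<bar>f x\<bar>)"
    using absolutely_integrable_imp_integrable[OF assms(2)] by simp
  have "0 \<le> (LINT x|lebesgue_on unit_ivl. (\<bar>f x\<bar> - d)\<^sup>2)" by simp
  also have "\<dots> = (LINT x|lebesgue_on unit_ivl. ((f x)\<^sup>2 - 2 * d * \<bar>f x\<bar>) + d\<^sup>2)"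
    by (intro Bochner_Integration.integral_cong refl) (simp add: power2_diff)
  also have "\<dots> = (LINT x|lebesgue_on unit_ivl. (f x)\<^sup>2) - d\<^sup>2"
  proof -
    have "integrable (lebesgue_on unit_ivl) (\<lambda>x. d\<^sup>2)"
      by (intro finite_measure.integrable_const finite_measure_lebesgue_on) auto
    then have "(LINT x|lebesgue_on unit_ivl. ((f x)\<^sup>2 - 2 * d * \<bar>f x\<bar>) + d\<^sup>2)
        = (LINT x|lebesgue_on unit_ivl. (f x)\<^sup>2) - 2 * d * (LINT x|lebesgue_on unit_ivl. \<bar>f x\<bar>) + d\<^sup>2"
      using i1 i2 by (simp add: measure_restrict_space)
    then show ?thesis by (simp add: L1_norm_def[symmetric] d_def[symmetric] power2_eq_square)
  qed
  finally show ?thesis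
    unfolding L2_norm_def d_def[symmetric] by (intro real_le_rsqrt) simp
qed

section \<open>Stability of solutions\<close>

text \<open>The common reduction for both ranges of \<open>r\<close>: the premises of
  \<open>lip\<close> collect what holds at every point for the two primitives, so \<open>C\<close>
  bounds the difference of the derivatives and, after integration over length at most 1, that of the
  solutions.\<close>

lemma p_poisson_solutions_distance:
  assumes p: "p > 1" and r: "r = 1 / (p - 1)"
    and g: "g \<in> L2_space unit_ivl" "g2 \<in> L2_space unit_ivl"
    and sol: "p_poisson_solution p g u" "p_poisson_solution p g2 u2"
    and lip: "\<And>a b. \<lbrakk>\<bar>a\<bar> \<le> L1_norm unit_ivl g; \<bar>b\<bar> \<le> L1_norm unit_ivl g2;
        \<bar>a - b\<bar> \<le> L1_norm unit_ivl (\<lambda>x. g x - g2 x)\<rbrakk> \<Longrightarrow> \<bar>spow a r - spow b r\<bar> \<le> C"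
  shows "L2_norm unit_ivl (\<lambda>x. u x - u2 x) \<le> C"
proof -
  have r0: "r > 0" using p r by simp
  note gi = L2_space_absolutely_integrable(2)[OF g(1)] L2_space_absolutely_integrable(2)[OF g(2)]
  obtain c where c: "\<forall>x\<in>{0..1}. u x = integral {0..x} (\<lambda>t. spow (c + integral {0..t} g) r)"
    by (rule p_poisson_solution_integral_form[OF p r g(1) sol(1)])
  obtain c2 where c2: "\<forall>x\<in>{0..1}. u2 x = integral {0..x} (\<lambda>t. spow (c2 + integral {0..t} g2) r)"
    by (rule p_poisson_solution_integral_form[OF p r g(2) sol(2)])
  have z: "integral {0..1} (\<lambda>t. spow (c + integral {0..t} g) r) = 0"
    "integral {0..1} (\<lambda>t. spow (c2 + integral {0..t} g2) r) = 0"
    using bspec[OF c, of 1] bspec[OF c2, of 1] sol by (auto simp: p_poisson_solution_def)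
  \<comment> \<open>The comparison function is the zero primitive, whose signed power also has
    integral zero.\<close>
  have single: "\<bar>c + integral {0..x} g\<bar> \<le> L1_norm unit_ivl g"
    if "g absolutely_integrable_on {0..1}" "x \<in> {0..1}"
      "integral {0..1} (\<lambda>t. spow (c + integral {0..t} g) r) = 0" for c x and g :: "real \<Rightarrow> real"
    using primitives_distance_le_L1_norm[of g "\<lambda>_. 0" r c 0 x] that r0
    by (simp add: spow_def)
  define w where "w t = spow (c + integral {0..t} g) r - spow (c2 + integral {0..t} g2) r" for t
  have cont: "continuous_on {0..1} (\<lambda>t. spow (c + integral {0..t} g) r)"
    if "g absolutely_integrable_on {0..1}" for c and g :: "real \<Rightarrow> real"
    using that r0
    by (intro continuous_intros indefinite_integral_continuous_1) (auto simp: absolutely_integrable_on_def)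
  have wc: "continuous_on {0..1} w"
    unfolding w_def by (intro continuous_on_diff cont gi)
  have wC: "\<bar>w t\<bar> \<le> C" if "t \<in> {0..1}" for t
    unfolding w_def using that gi r0 z
    by (intro lip single primitives_distance_le_L1_norm) auto
  show ?thesis
  proof (rule L2_norm_le_bound)
    show "continuous_on {0..1} (\<lambda>x. u x - u2 x)"
      using sol by (auto simp: p_poisson_solution_def intro!: continuous_intros)
    fix x :: real assume x: "x \<in> {0..1}"
    have sub: "continuous_on {0..x} (\<lambda>t. spow (c + integral {0..t} g) r)"
      if "g absolutely_integrable_on {0..1}" for c and g :: "real \<Rightarrow> real"
      using cont[OF that] by (rule continuous_on_subset) (use x in auto)
    have "u x - u2 x = integral {0..x} w"
      unfolding w_def bspec[OF c x] bspec[OF c2 x]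
      by (intro integral_diff[symmetric] integrable_continuous_real sub gi)
    moreover have "norm (integral {0..x} w) \<le> C * (x - 0)"
      by (rule integral_bound) (use x wC in \<open>auto intro: continuous_on_subset[OF wc]\<close>)
    moreover have "C * x \<le> C"
      using x order_trans[OF abs_ge_zero wC[of 0]] by (intro mult_left_le) auto
    ultimately show "\<bar>u x - u2 x\<bar> \<le> C" by simp
  qed
qed

theorem theorem5:
  fixes p r m :: real and g g2 u u2 :: "real \<Rightarrow> real"
  assumes "p > 1"
    and "r = 1 / (p - 1)"
    and "g \<in> L2_space unit_ivl"
    and "g2 \<in> L2_space unit_ivl"
    and "p_poisson_solution p g u"
    and "p_poisson_solution p g2 u2"
    and "m = max (L1_norm unit_ivl g) (L1_norm unit_ivl g2)"
  shows "(0 < r \<and> r \<le> 1 \<longrightarrow>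
            L2_norm unit_ivl (\<lambda>x. u x - u2 x)
              \<le> 2 powr (1 - r) *
                (L2_norm unit_ivl (\<lambda>x. g x - g2 x)
                  + (4 * m) powr (1 - r) / r * L1_norm unit_ivl (\<lambda>x. g x - g2 x) powr r) powr r)
       \<and> (r > 1 \<longrightarrow>
            L2_norm unit_ivl (\<lambda>x. u x - u2 x)
              \<le> r * 2 powr (r - 1) * m powr (r - 1) *
                (L2_norm unit_ivl (\<lambda>x. g x - g2 x)
                  + 2 powr (2 - 2 / r) * m powr (1 - 1 / r) * r powr (1 / r)
                    * L1_norm unit_ivl (\<lambda>x. g x - g2 x) powr (1 / r)))"
proof -
  define d where "d = L1_norm unit_ivl (\<lambda>x. g x - g2 x)"
  define D where "D = L2_norm unit_ivl (\<lambda>x. g x - g2 x)"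
  note gi = L2_space_absolutely_integrable(1)[OF assms(3)] L2_space_absolutely_integrable(1)[OF assms(4)]
  note dist = p_poisson_solutions_distance[OF assms(1-6)]
  have meas [measurable]: "g \<in> borel_measurable (lebesgue_on unit_ivl)" "g2 \<in> borel_measurable (lebesgue_on unit_ivl)"
    and sq: "integrable (lebesgue_on unit_ivl) (\<lambda>x. (g x)\<^sup>2)" "integrable (lebesgue_on unit_ivl) (\<lambda>x. (g2 x)\<^sup>2)"
    using assms(3,4) by (auto simp: L2_space_def)
  have d0: "0 \<le> d" by (simp add: d_def L1_norm_def)
  have "d \<le> L1_norm unit_ivl g + L1_norm unit_ivl g2"
  proof -
    have i: "integrable (lebesgue_on unit_ivl) (\<lambda>x. \<bar>g x\<bar>)" "integrable (lebesgue_on unit_ivl) (\<lambda>x. \<bar>g2 x\<bar>)"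
      "integrable (lebesgue_on unit_ivl) (\<lambda>x. \<bar>g x - g2 x\<bar>)"
      using gi[THEN absolutely_integrable_imp_integrable] by auto
    then have "d \<le> (LINT x|lebesgue_on unit_ivl. \<bar>g x\<bar> + \<bar>g2 x\<bar>)"
      unfolding d_def L1_norm_def by (intro integral_mono) auto
    also have "\<dots> = L1_norm unit_ivl g + L1_norm unit_ivl g2"
      using i by (simp add: L1_norm_def)
    finally show ?thesis .
  qed
  then have dm: "d \<le> 2 * m" using assms(7) by auto
  have dD: "d \<le> D"
    unfolding d_def D_def
  proof (rule L1_norm_le_L2_norm)
    show "(\<lambda>x. g x - g2 x) absolutely_integrable_on unit_ivl"
      using gi by (rule set_integral_diff(1))
    have "integrable (lebesgue_on unit_ivl) (\<lambda>x. 2 * (g x)\<^sup>2 + 2 * (g2 x)\<^sup>2)"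
      using sq by auto
    then show "integrable (lebesgue_on unit_ivl) (\<lambda>x. (g x - g2 x)\<^sup>2)"
    \<comment> \<open>The majorant minus the square of \<open>g - g2\<close> is the square of
      \<open>g + g2\<close>.\<close>
    proof (rule Bochner_Integration.integrable_bound, goal_cases)
      case 2
      have "(g x - g2 x)\<^sup>2 \<le> 2 * (g x)\<^sup>2 + 2 * (g2 x)\<^sup>2" for x
        using zero_le_power2[of "g x + g2 x"] by (simp add: power2_eq_square algebra_simps)
      then show ?case by simp
    qed measurable
  qed measurable
  have small: "L2_norm unit_ivl (\<lambda>x. u x - u2 x) \<le> 2 powr (1 - r) * (D + (4 * m) powr (1 - r) / r * d powr r) powr r"
    if r: "0 < r" "r \<le> 1"
  proof -
    have "L2_norm unit_ivl (\<lambda>x. u x - u2 x) \<le> 2 * d powr r"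
    proof (rule dist)
      fix a b assume "\<bar>a - b\<bar> \<le> L1_norm unit_ivl (\<lambda>x. g x - g2 x)"
      then have "\<bar>a - b\<bar> powr r \<le> d powr r" using r by (intro powr_mono2) (auto simp: d_def)
      then show "\<bar>spow a r - spow b r\<bar> \<le> 2 * d powr r" using spow_diff_Holder[OF r, of a b] by simp
    qed
    \<comment> \<open>Two copies of \<open>d\<close> are produced because the target has two
      summands: \<open>D\<close> dominates one copy, and the L1 term dominates the other.\<close>
    also have "2 * d powr r = 2 powr (1 - r) * (d + d) powr r"
    proof -
      have "(d + d) powr r = 2 powr r * d powr r" using d0 by (simp add: powr_mult mult_2[symmetric])
      then show ?thesis by (simp add: powr_diff)
    qed
    also have "\<dots> \<le> 2 powr (1 - r) * (D + (4 * m) powr (1 - r) / r * d powr r) powr r"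
    proof -
      \<comment> \<open>Split off \<open>d powr (1 - r)\<close>, bound it through d \<le> 2m \<le>
        4m, and use 1 \<le> 1/r.\<close>
      have "d \<le> (4 * m) powr (1 - r) / r * d powr r"
      proof (cases "d = 0")
        case False
        then have "d = d powr (1 - r) * d powr r" using d0 by (simp add: powr_add[symmetric])
        also have "\<dots> \<le> (4 * m) powr (1 - r) * d powr r"
          using d0 dm r by (intro mult_right_mono powr_mono2) auto
        also have "\<dots> \<le> (4 * m) powr (1 - r) / r * d powr r"
          using r by (intro mult_right_mono) (auto simp: le_divide_eq mult_left_le)
        finally show ?thesis .
      qed simp
      then show ?thesis using r d0 dD by (intro mult_left_mono powr_mono2 add_mono) auto
    qed
    finally show ?thesis .
  qed
  have large: "L2_norm unit_ivl (\<lambda>x. u x - u2 x) \<le> r * 2 powr (r - 1) * m powr (r - 1) *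
      (D + 2 powr (2 - 2 / r) * m powr (1 - 1 / r) * r powr (1 / r) * d powr (1 / r))"
    if r: "1 < r"
  proof -
    have "L2_norm unit_ivl (\<lambda>x. u x - u2 x) \<le> r * m powr (r - 1) * d"
    proof (rule dist)
      fix a b assume "\<bar>a\<bar> \<le> L1_norm unit_ivl g" "\<bar>b\<bar> \<le> L1_norm unit_ivl g2"
        and ab: "\<bar>a - b\<bar> \<le> L1_norm unit_ivl (\<lambda>x. g x - g2 x)"
      then have "\<bar>spow a r - spow b r\<bar> \<le> r * m powr (r - 1) * \<bar>a - b\<bar>"
        using r assms(7) by (intro spow_diff_Lipschitz) auto
      also have "\<dots> \<le> r * m powr (r - 1) * d"
        using ab r by (intro mult_left_mono) (auto simp: d_def)
      finally show "\<bar>spow a r - spow b r\<bar> \<le> r * m powr (r - 1) * d" .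
    qed
    \<comment> \<open>The slack is generous: \<open>2 powr (r - 1)\<close> is at least 1, d \<le> D,
      and the second summand is nonnegative.\<close>
    also have "\<dots> \<le> r * (2 powr (r - 1) * m powr (r - 1)) *
      (D + 2 powr (2 - 2 / r) * m powr (1 - 1 / r) * r powr (1 / r) * d powr (1 / r))"
    proof (intro mult_mono mult_left_mono)
      show "m powr (r - 1) \<le> 2 powr (r - 1) * m powr (r - 1)"
        using r ge_one_powr_ge_zero[of 2 "r - 1"] by (simp add: mult_le_cancel_right1)
      show "d \<le> D + 2 powr (2 - 2 / r) * m powr (1 - 1 / r) * r powr (1 / r) * d powr (1 / r)"
        using dD by (intro add_increasing2) auto
    qed (use r d0 in auto)
    finally show ?thesis by (simp add: mult.assoc)
  qed
  show ?thesis
    unfolding d_def[symmetric] D_def[symmetric] by (intro conjI impI small large) auto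
qed

end
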